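(* For every digraph $\vec{H}$, the class of $\vec{H}$-free strongly connected digraphs has unbounded cop number; that is, there is no constant $C$ such that $c(\vec{D})\le C$ for every strongly connected $\vec{H}$-free digraph $\vec{D}$.
   Context: A digraph is a finite directed graph with no loops and no parallel arcs (two arcs with the same tail and the same head), which is weakly connected (its underlying undirected graph is connected). A pair of opposite arcs $uv$ and $vu$ is allowed. Game of cops and robbers on a digraph $\vec{D}$: the cop player has $k\ge 1$ pieces (cops) and the robber has one piece. First the cop player places the $k$ cops on (not necessarily distinct) vertices, then the robber chooses a vertex. In each round, first each cop either stays or moves along an arc from its current vertex (tail) to the head of that arc; then the robber either stays or moves along an arc from tail to head. The cops win if at some point some cop is on the same vertex as the robber; the robber wins if he is never caught. Both players have complete information. The cop number $c(\vec{D})$ is the minimum $k$ such that $k$ cops have a winning strategy. A digraph is $\vec{H}$-free if it contains no induced subdigraph isomorphic to $\vec{H}$. A class of digraphs has bounded cop number if there is a constant $C$ such that every digraph in the class has cop number at most $C$; otherwise the class has unbounded cop number.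
   Formalization: The digraph H is required to have at least two vertices: for the one-vertex H no digraph is H-free, so the class is empty and trivially bounded, and the claim as printed fails there. *)

theory Defs
  imports "Graph_Theory.Graph_Theory"
begin

text \<open>
  The locale \<^locale>\<open>digraph\<close> provides finiteness and excludes loops and parallel arcs
  (opposite arcs are allowed); weak connectedness is added here. In particular, a digraph
  has at least one vertex.
\<close>

definition weakly_connected_digraph :: "('a, 'b) pre_digraph \<Rightarrow> bool" where
  "weakly_connected_digraph G \<longleftrightarrow> digraph G \<and> Digraph_Component.connected G"

definition induced_free :: "('a, 'b) pre_digraph \<Rightarrow> ('c, 'd) pre_digraph \<Rightarrow> bool" where
  "induced_free H G \<longleftrightarrow> \<not> (\<exists>S. induced_subgraph S G \<and> digraph_iso S H)"

definition legal_move :: "('a, 'b) pre_digraph \<Rightarrow> 'a \<Rightarrow> 'a \<Rightarrow> bool" where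
  "legal_move G u v \<longleftrightarrow> v = u \<or> u \<rightarrow>\<^bsub>G\<^esub> v"

definition robber_play :: "('a, 'b) pre_digraph \<Rightarrow> (nat \<Rightarrow> 'a) \<Rightarrow> bool" where
  "robber_play G r \<longleftrightarrow> r 0 \<in> verts G \<and> (\<forall>t. legal_move G (r t) (r (Suc t)))"

text \<open>
  A strategy of the cops maps the list of all robber positions so far (oldest first) to the
  next positions of the cops, cop \<open>i\<close> being placed at \<open>\<sigma> rs i\<close>. The empty list yields the
  initial placement. Since the strategy is fixed, the earlier positions of the cops are
  determined by the robber's history and need not be passed to it.
\<close>

type_synonym 'a cop_strategy = "'a list \<Rightarrow> nat \<Rightarrow> 'a"

definition cop_position :: "'a cop_strategy \<Rightarrow> (nat \<Rightarrow> 'a) \<Rightarrow> nat \<Rightarrow> nat \<Rightarrow> 'a" where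
  "cop_position \<sigma> r t = \<sigma> (map r [0..<t])"

definition legal_cop_strategy ::
    "('a, 'b) pre_digraph \<Rightarrow> nat \<Rightarrow> 'a cop_strategy \<Rightarrow> bool" where
  "legal_cop_strategy G k \<sigma> \<longleftrightarrow>
     (\<forall>i<k. \<sigma> [] i \<in> verts G) \<and>
     (\<forall>r. robber_play G r \<longrightarrow>
        (\<forall>t. \<forall>i<k. legal_move G (cop_position \<sigma> r t i) (cop_position \<sigma> r (Suc t) i)))"

text \<open>
  The order of events is: cops at time 0, robber at time 0, cops at time 1, robber at time 1,
  and so on. Hence a capture occurs either on a robber's turn (both at time \<open>t\<close>) or on a
  cops' turn (cops at time \<open>Suc t\<close>, robber still at his position of time \<open>t\<close>). Positions
  after a capture are irrelevant; robber plays are infinite because staying is always legal.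
\<close>

definition captured ::
    "nat \<Rightarrow> 'a cop_strategy \<Rightarrow> (nat \<Rightarrow> 'a) \<Rightarrow> bool" where
  "captured k \<sigma> r \<longleftrightarrow>
     (\<exists>t. \<exists>i<k. cop_position \<sigma> r t i = r t \<or> cop_position \<sigma> r (Suc t) i = r t)"

definition cops_win :: "('a, 'b) pre_digraph \<Rightarrow> nat \<Rightarrow> bool" where
  "cops_win G k \<longleftrightarrow>
     (\<exists>\<sigma>. legal_cop_strategy G k \<sigma> \<and> (\<forall>r. robber_play G r \<longrightarrow> captured k \<sigma> r))"

text \<open>
  On a finite nonempty digraph the minimum exists, as one cop per vertex suffices.
\<close>

definition cop_number :: "('a, 'b) pre_digraph \<Rightarrow> nat" where
  "cop_number G = (LEAST k. 1 \<le> k \<and> cops_win G k)"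

definition bounded_cop_number :: "('a, 'b) pre_digraph set \<Rightarrow> bool" where
  "bounded_cop_number \<D> \<longleftrightarrow> (\<exists>C. \<forall>D\<in>\<D>. cop_number D \<le> C)"

text \<open>
  Digraphs being finite, every isomorphism type has a representative whose vertices are
  natural numbers and whose arcs are pairs of natural numbers. If \<open>H\<close> has just one vertex, the class is
  empty and thus trivially bounded, so unboundedness can only hold for \<open>H\<close> with at least
  two vertices.
\<close>

definition free_strong_digraphs :: "('a, 'b) pre_digraph \<Rightarrow> (nat, nat \<times> nat) pre_digraph set" where
  "free_strong_digraphs H =
     {D. weakly_connected_digraph D \<and> strongly_connected D \<and> induced_free H D}"

end

theory Submission
  imports Defs "HOL-Number_Theory.Cong"
begin

text \<open>
  A digraph in which any two distinct vertices have at most one common out-neighbour is hard for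
  the cops: if the robber stands on \<open>v\<close>, a cop on \<open>u \<noteq> v\<close> spoils at most two out-neighbours of \<open>v\<close>,
  namely \<open>u\<close> itself and the common out-neighbour of \<open>u\<close> and \<open>v\<close>. When all out-degrees exceed
  \<open>2 * k\<close>, the robber therefore always has a move to a vertex that none of \<open>k\<close> cops can reach in one
  step, and he is never caught (\<open>robber_escapes\<close>).

  Two families of strongly connected digraphs on the residues modulo \<open>n = 2 ^ Suc m\<close> have this
  property with out-degree tending to infinity. Both rest on the fact that an unordered pair of
  powers of two with exponents below \<open>m\<close> is determined by its sum modulo \<open>n\<close>.
  In the first family the arcs lead from \<open>x\<close> to \<open>x + 2 ^ i\<close>; this digraph has no pair of opposite
  arcs. In the second, \<open>x\<close> and \<open>y\<close> are joined when \<open>x + y\<close> is a power of two; this digraph is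
  symmetric.

  The two families suffice for every \<open>H\<close>. Symmetry passes to induced subdigraphs, so if \<open>H\<close> is not
  symmetric, then the symmetric family is \<open>H\<close>-free. If \<open>H\<close> is symmetric, then, being connected with at
  least two vertices, it has an arc and hence a pair of opposite arcs, so the oriented family is
  \<open>H\<close>-free.
\<close>

section \<open>A strategy for the robber\<close>

text \<open>
  The bound \<open>2 * k\<close> is a union bound: the cop on \<open>c i\<close> excludes only \<open>c i\<close> itself and the
  out-neighbours that \<open>c i\<close> shares with \<open>v\<close>.
\<close>

lemma safe_out_neighbour:
  fixes G :: "('a, 'b) pre_digraph"
  assumes "fin_digraph G" "\<And>i. i < k \<Longrightarrow> c i \<noteq> v"
    and deg: "2 * k < card {w. v \<rightarrow>\<^bsub>G\<^esub> w}"
    and common: "\<And>u. u \<noteq> v \<Longrightarrow> card {w. u \<rightarrow>\<^bsub>G\<^esub> w \<and> v \<rightarrow>\<^bsub>G\<^esub> w} \<le> 1"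
  shows "\<exists>w. v \<rightarrow>\<^bsub>G\<^esub> w \<and> (\<forall>i<k. \<not> legal_move G (c i) w)"
proof (rule ccontr)
  interpret fin_digraph G by fact
  let ?B = "\<lambda>i. insert (c i) {w. c i \<rightarrow>\<^bsub>G\<^esub> w \<and> v \<rightarrow>\<^bsub>G\<^esub> w}"
  assume "\<not> ?thesis"
  then have sub: "{w. v \<rightarrow>\<^bsub>G\<^esub> w} \<subseteq> (\<Union>i<k. ?B i)"
    unfolding legal_move_def by blast
  have fin: "finite {w. u \<rightarrow>\<^bsub>G\<^esub> w \<and> v \<rightarrow>\<^bsub>G\<^esub> w}" for u
    by (rule finite_subset[OF _ finite_verts]) (auto dest: adj_in_verts)
  have "card {w. v \<rightarrow>\<^bsub>G\<^esub> w} \<le> card (\<Union>i<k. ?B i)"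
    by (rule card_mono[OF _ sub]) (use fin in auto)
  also have "\<dots> \<le> (\<Sum>i<k. card (?B i))"
    by (rule card_UN_le) simp
  also have "\<dots> \<le> (\<Sum>i<k. 2)"
  proof (rule sum_mono)
    fix i assume "i \<in> {..<k}"
    with assms(2) have "card {w. c i \<rightarrow>\<^bsub>G\<^esub> w \<and> v \<rightarrow>\<^bsub>G\<^esub> w} \<le> 1"
      by (intro common) auto
    then show "card (?B i) \<le> 2"
      using card_insert_le_m1[of 2 "{w. c i \<rightarrow>\<^bsub>G\<^esub> w \<and> v \<rightarrow>\<^bsub>G\<^esub> w}" "c i"] by simp
  qed
  finally show False using deg by simp
qed

text \<open>
  The robber's first \<open>t\<close> positions when \<open>f\<close> chooses each position from the list of the previous
  ones. The cops' answers enter only through \<open>f\<close>: a fixed cop strategy is itself a function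
  of this list.
\<close>

primrec robber_history :: "('a list \<Rightarrow> 'a) \<Rightarrow> nat \<Rightarrow> 'a list" where
  "robber_history f 0 = []"
| "robber_history f (Suc t) = robber_history f t @ [f (robber_history f t)]"

lemma robber_history_conv: "robber_history f t = map (\<lambda>s. f (robber_history f s)) [0..<t]"
  by (induction t) auto

text \<open>
  The invariant is that after each of his moves the robber stands on a vertex that no cop can reach
  in one step. After the cops' answer he is still free, and \<open>safe_out_neighbour\<close> restores
  the invariant. For the start he picks a vertex \<open>v0\<close> without a cop and enters the game at a safe
  out-neighbour of \<open>v0\<close>, as if he had just moved there.
\<close>

theorem robber_escapes:
  fixes G :: "('a, 'b) pre_digraph"
  assumes G: "fin_digraph G" and ne: "verts G \<noteq> {}"
    and deg: "\<And>v. v \<in> verts G \<Longrightarrow> 2 * k < card {w. v \<rightarrow>\<^bsub>G\<^esub> w}"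
    and common: "\<And>u v. u \<noteq> v \<Longrightarrow> card {w. u \<rightarrow>\<^bsub>G\<^esub> w \<and> v \<rightarrow>\<^bsub>G\<^esub> w} \<le> 1"
  shows "\<not> cops_win G k"
proof
  interpret fin_digraph G by fact
  assume "cops_win G k"
  then obtain \<sigma> where legal: "legal_cop_strategy G k \<sigma>"
    and win: "\<And>r. robber_play G r \<Longrightarrow> captured k \<sigma> r"
    unfolding cops_win_def by blast
  obtain v1 where v1: "v1 \<in> verts G" using ne by auto
  have "card {w. v1 \<rightarrow>\<^bsub>G\<^esub> w} \<le> card (verts G)"
    by (rule card_mono) (auto dest: adj_in_verts)
  then have "card (\<sigma> [] ` {..<k}) < card (verts G)"
    using deg[OF v1] card_image_le[of "{..<k}" "\<sigma> []"] by simp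
  then have "\<not> verts G \<subseteq> \<sigma> [] ` {..<k}"
    using card_mono[of "\<sigma> [] ` {..<k}" "verts G"] by auto
  then obtain v0 where v0: "v0 \<in> verts G" "\<And>i. i < k \<Longrightarrow> \<sigma> [] i \<noteq> v0" by auto
  \<comment> \<open>The cops' moves are known to be legal only against a robber who plays legally throughout.
    So \<open>f\<close> falls back to staying put when there is no safe move, which makes every position he
    chooses legal before it is known that safe moves always exist.\<close>
  define safe where "safe h w \<longleftrightarrow> (\<forall>i<k. \<not> legal_move G (\<sigma> h i) w)" for h w
  define pos where "pos h = (if h = [] then v0 else last h)" for h
  define f where "f h = (if \<exists>w. pos h \<rightarrow>\<^bsub>G\<^esub> w \<and> safe h w
      then SOME w. pos h \<rightarrow>\<^bsub>G\<^esub> w \<and> safe h w else pos h)" for h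
  define r where "r t = f (robber_history f t)" for t
  have hist: "map r [0..<t] = robber_history f t" for t
    using robber_history_conv[of f t] by (simp add: r_def[abs_def])
  have f_legal: "legal_move G (pos h) (f h)" for h
    unfolding f_def legal_move_def using someI_ex[of "\<lambda>w. pos h \<rightarrow>\<^bsub>G\<^esub> w \<and> safe h w"] by simp
  have f_safe: "safe h (f h)" if "pos h \<in> verts G" "\<And>i. i < k \<Longrightarrow> \<sigma> h i \<noteq> pos h" for h
  proof -
    have "\<exists>w. pos h \<rightarrow>\<^bsub>G\<^esub> w \<and> (\<forall>i<k. \<not> legal_move G (\<sigma> h i) w)"
    proof (rule safe_out_neighbour[where c = "\<sigma> h" and v = "pos h"])
      show "2 * k < card {w. pos h \<rightarrow>\<^bsub>G\<^esub> w}" using that(1) by (rule deg)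
    qed (use G that(2) common in simp_all)
    then have "\<exists>w. pos h \<rightarrow>\<^bsub>G\<^esub> w \<and> safe h w"
      unfolding safe_def .
    then have "pos h \<rightarrow>\<^bsub>G\<^esub> f h \<and> safe h (f h)"
      unfolding f_def using someI_ex[of "\<lambda>w. pos h \<rightarrow>\<^bsub>G\<^esub> w \<and> safe h w"] by simp
    then show ?thesis ..
  qed
  have pos_Suc: "pos (robber_history f (Suc t)) = r t" for t
    by (simp add: pos_def r_def)
  have r0: "r 0 \<in> verts G"
    using f_legal[of "[]"] v0 by (auto simp: r_def pos_def legal_move_def dest: adj_in_verts)
  have r_legal: "legal_move G (r t) (r (Suc t))" for t
    using f_legal[of "robber_history f (Suc t)"] unfolding pos_Suc by (simp add: r_def)
  have play: "robber_play G r"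
    unfolding robber_play_def using r0 r_legal by blast
  have r_verts: "r t \<in> verts G" for t
  proof (induction t)
    case (Suc t)
    then show ?case using r_legal[of t] by (auto simp: legal_move_def dest: adj_in_verts)
  qed (rule r0)
  have cops_legal: "legal_move G (cop_position \<sigma> r t i) (cop_position \<sigma> r (Suc t) i)"
    if "i < k" for t i
    using legal play that unfolding legal_cop_strategy_def by blast
  have next_ne: "cop_position \<sigma> r (Suc t) i \<noteq> r t" if "safe (robber_history f t) (r t)" "i < k" for t i
    using that cops_legal[of i t] unfolding safe_def by (auto simp: cop_position_def hist)
  have r_safe: "safe (robber_history f t) (r t)" for t
  proof (induction t)
    case 0
    then show ?case using f_safe[of "[]"] v0 by (simp add: pos_def r_def)
  next
    case (Suc t)
    have "safe (robber_history f (Suc t)) (f (robber_history f (Suc t)))"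
    proof (rule f_safe)
      show "pos (robber_history f (Suc t)) \<in> verts G" unfolding pos_Suc by (rule r_verts)
    next
      fix i assume "i < k"
      from next_ne[OF Suc this] show "\<sigma> (robber_history f (Suc t)) i \<noteq> pos (robber_history f (Suc t))"
        unfolding pos_Suc cop_position_def hist .
    qed
    then show ?case by (simp add: r_def)
  qed
  from win[OF play] obtain t i where "i < k"
    "cop_position \<sigma> r t i = r t \<or> cop_position \<sigma> r (Suc t) i = r t"
    unfolding captured_def by blast
  with next_ne[OF r_safe[of t]] r_safe[of t] show False
    unfolding safe_def by (auto simp: cop_position_def hist legal_move_def)
qed

text \<open>
  The cop number is a least element, which says something about winning only if some
  number of cops does win: one cop standing on each vertex catches the robber where he starts.
\<close>

lemma cops_win_card_verts:
  fixes G :: "('a, 'b) pre_digraph"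
  assumes "finite (verts G)"
  shows "cops_win G (card (verts G))"
proof -
  from assms obtain g where g: "bij_betw g {..<card (verts G)} (verts G)"
    using ex_bij_betw_nat_finite[OF assms] by (auto simp: atLeast0LessThan)
  let ?\<sigma> = "\<lambda>h::'a list. g"
  have "legal_cop_strategy G (card (verts G)) ?\<sigma>"
    unfolding legal_cop_strategy_def legal_move_def cop_position_def
    using bij_betwE[OF g] by auto
  moreover have "captured (card (verts G)) ?\<sigma> r" if "robber_play G r" for r
  proof -
    have "r 0 \<in> g ` {..<card (verts G)}"
      using that bij_betw_imp_surj_on[OF g] by (simp add: robber_play_def)
    then obtain i where "i < card (verts G)" "g i = r 0" by auto
    then show ?thesis
      unfolding captured_def cop_position_def by blast
  qed
  ultimately show ?thesis unfolding cops_win_def by blast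
qed

lemma less_cop_number:
  fixes G :: "('a, 'b) pre_digraph"
  assumes G: "fin_digraph G" and ne: "verts G \<noteq> {}"
    and deg: "\<And>v. v \<in> verts G \<Longrightarrow> 2 * C < card {w. v \<rightarrow>\<^bsub>G\<^esub> w}"
    and common: "\<And>u v. u \<noteq> v \<Longrightarrow> card {w. u \<rightarrow>\<^bsub>G\<^esub> w \<and> v \<rightarrow>\<^bsub>G\<^esub> w} \<le> 1"
  shows "C < cop_number G"
proof -
  interpret fin_digraph G by fact
  have "\<exists>k\<ge>1. cops_win G k"
    using cops_win_card_verts[of G] ne
    by (intro exI[of _ "card (verts G)"]) (simp add: Suc_le_eq card_gt_0_iff)
  then have "cops_win G (cop_number G)"
    unfolding cop_number_def by (metis (mono_tags, lifting) LeastI_ex)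
  moreover have "\<not> cops_win G k" if "k \<le> C" for k
    using that deg by (intro robber_escapes G ne common) (meson le_less_trans mult_le_mono2)
  ultimately show ?thesis by (meson not_less)
qed

section \<open>Powers of two modulo a larger power of two\<close>

text \<open>
  Uniqueness of the pair is proved by comparing parities: an odd sum has exactly one summand
  equal to \<open>1\<close>, and in an even sum without summands \<open>1\<close> everything can be halved.
\<close>

lemma power_two_sums_eq:
  fixes a b c d :: nat
  assumes "(2::nat) ^ a + 2 ^ d = 2 ^ b + 2 ^ c"
  shows "a = b \<or> a = c"
  using assms
proof (induction a arbitrary: b c d)
  case 0
  show ?case
  proof (rule ccontr)
    assume "\<not> ?thesis"
    then obtain b' c' where "b = Suc b'" "c = Suc c'" by (cases b; cases c) auto
    with 0 have "1 + (2::nat) ^ d = 2 * (2 ^ b' + 2 ^ c')" by simp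
    moreover from this have "even (1 + (2::nat) ^ d)" by (simp only: dvd_triv_left)
    then have "d = 0" by simp
    moreover have "(1::nat) \<le> 2 ^ b'" "(1::nat) \<le> 2 ^ c'" by simp_all
    ultimately show False by simp
  qed
next
  case (Suc a)
  have pos: "(1::nat) \<le> 2 ^ a" by simp
  show ?case
  proof (cases "b = 0 \<or> c = 0 \<or> d = 0")
    case True
    have "even ((2::nat) ^ b + 2 ^ c) = even ((2::nat) ^ d)"
      unfolding Suc.prems[symmetric] by simp
    then have "even ((2::nat) ^ b) = even ((2::nat) ^ c) \<longleftrightarrow> d \<noteq> 0" by simp
    with True consider "b = 0" "c = 0" "d \<noteq> 0" | "b = 0" "d = 0" | "c = 0" "d = 0"
      by fastforce
    then show ?thesis
    proof cases
      case 1
      with Suc.prems have "2 * 2 ^ a + 2 ^ d = (2::nat)" by simp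
      moreover have "(0::nat) < 2 ^ d" by simp
      ultimately show ?thesis using pos by linarith
    qed (use Suc.prems in \<open>auto simp flip: power_Suc simp: power_inject_exp\<close>)
  next
    case False
    then obtain b' c' d' where "b = Suc b'" "c = Suc c'" "d = Suc d'"
      by (cases b; cases c; cases d) auto
    with Suc.prems Suc.IH[of d' b' c'] show ?thesis by simp
  qed
qed

text \<open>
  The modulus exceeds every sum of two of the powers in question, so the congruence is an equation.
\<close>

lemma power_two_sums_cong:
  fixes a b c d m :: nat
  assumes "[2 ^ a + 2 ^ d = 2 ^ b + 2 ^ c] (mod (2::nat) ^ Suc m)"
    and "a < m" "b < m" "c < m" "d < m"
  shows "a = b \<or> a = c"
proof -
  have "(2::nat) ^ i + 2 ^ j < 2 ^ Suc m" if "i < m" "j < m" for i j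
  proof -
    have "(2::nat) ^ i < 2 ^ m" "(2::nat) ^ j < 2 ^ m" using that by simp_all
    then show ?thesis unfolding power_Suc by linarith
  qed
  then have "(2::nat) ^ a + 2 ^ d = 2 ^ b + 2 ^ c"
    using assms cong_less_modulus_unique_nat by blast
  then show ?thesis by (rule power_two_sums_eq)
qed

lemma power_two_cong:
  fixes a b m :: nat
  assumes "[2 ^ a = 2 ^ b] (mod (2::nat) ^ Suc m)" "a < m" "b < m"
  shows "a = b"
proof -
  have "[2 ^ a + 2 ^ a = 2 ^ b + 2 ^ b] (mod (2::nat) ^ Suc m)"
    using assms(1,1) by (rule cong_add)
  then have "a = b \<or> a = b"
    by (rule power_two_sums_cong) (use assms(2,3) in simp_all)
  then show ?thesis by simp
qed

section \<open>Two families of digraphs on the residues modulo a power of two\<close>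

definition residue_digraph :: "nat \<Rightarrow> (nat \<Rightarrow> nat \<Rightarrow> bool) \<Rightarrow> (nat, nat \<times> nat) pre_digraph" where
  "residue_digraph n P = \<lparr>verts = {..<n},
     arcs = {(x, y). x < n \<and> y < n \<and> x \<noteq> y \<and> P x y}, tail = fst, head = snd\<rparr>"

lemma verts_residue_digraph [simp]: "verts (residue_digraph n P) = {..<n}"
  by (simp add: residue_digraph_def)

lemma dominates_residue_digraph [simp]:
  "x \<rightarrow>\<^bsub>residue_digraph n P\<^esub> y \<longleftrightarrow> x < n \<and> y < n \<and> x \<noteq> y \<and> P x y"
  by (force simp: residue_digraph_def arcs_ends_conv)

lemma digraph_residue_digraph: "digraph (residue_digraph n P)"
proof
  show "finite (arcs (residue_digraph n P))"
    by (rule finite_subset[of _ "{..<n} \<times> {..<n}"]) (auto simp: residue_digraph_def)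
qed (auto simp: residue_digraph_def arc_to_ends_def)

text \<open>
  Walks from each residue to its successor combine to walks around the whole cycle.
\<close>

lemma strongly_connected_residue_digraph:
  assumes "0 < n"
    and step: "\<And>x. x < n \<Longrightarrow> x \<rightarrow>\<^sup>*\<^bsub>residue_digraph n P\<^esub> ((x + 1) mod n)"
  shows "strongly_connected (residue_digraph n P)"
proof
  interpret digraph "residue_digraph n P" by (rule digraph_residue_digraph)
  have walk: "u \<rightarrow>\<^sup>*\<^bsub>residue_digraph n P\<^esub> ((u + k) mod n)" if "u < n" for u k
  proof (induction k)
    case 0
    then show ?case using that by (simp add: reachable_refl)
  next
    case (Suc k)
    also have "((u + k) mod n) \<rightarrow>\<^sup>*\<^bsub>residue_digraph n P\<^esub> (((u + k) mod n + 1) mod n)"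
      using assms(1) by (intro step) simp
    finally show ?case by (simp add: mod_simps)
  qed
  fix u v assume "u \<in> verts (residue_digraph n P)" "v \<in> verts (residue_digraph n P)"
  then show "u \<rightarrow>\<^sup>*\<^bsub>residue_digraph n P\<^esub> v"
    using walk[of u "v + n - u"] by simp
qed (use assms in auto)

definition translation_digraph :: "nat \<Rightarrow> (nat, nat \<times> nat) pre_digraph" where
  "translation_digraph m =
     residue_digraph (2 ^ Suc m) (\<lambda>x y. \<exists>i<m. [x + 2 ^ i = y] (mod 2 ^ Suc m))"

definition sum_digraph :: "nat \<Rightarrow> (nat, nat \<times> nat) pre_digraph" where
  "sum_digraph m =
     residue_digraph (2 ^ Suc m) (\<lambda>x y. \<exists>i<m. [x + y = 2 ^ i] (mod 2 ^ Suc m))"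

lemma card_le_1I: "(\<And>x y. x \<in> A \<Longrightarrow> y \<in> A \<Longrightarrow> x = y) \<Longrightarrow> card A \<le> 1"
  by (metis One_nat_def card.infinite card_le_Suc0_iff_eq le_0_eq nat_le_linear)

text \<open>
  If \<open>w\<close> and \<open>w'\<close> are common out-neighbours with \<open>u + 2 ^ a = w = v + 2 ^ b\<close> and
  \<open>u + 2 ^ c = w' = v + 2 ^ d\<close>, then adding the equations crosswise gives
  \<open>2 ^ a + 2 ^ d = 2 ^ b + 2 ^ c\<close>. Now \<open>a = b\<close> would force \<open>u = v\<close>, and \<open>a = c\<close> gives \<open>w = w'\<close>.
  The symmetric family is treated by the same crosswise addition.
\<close>

lemma translation_digraph_common:
  assumes "u \<noteq> v"
  shows "card {w. u \<rightarrow>\<^bsub>translation_digraph m\<^esub> w \<and> v \<rightarrow>\<^bsub>translation_digraph m\<^esub> w} \<le> 1"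
proof (rule card_le_1I, safe)
  let ?n = "2 ^ Suc m :: nat"
  fix w w' assume A: "u \<rightarrow>\<^bsub>translation_digraph m\<^esub> w" "v \<rightarrow>\<^bsub>translation_digraph m\<^esub> w"
    "u \<rightarrow>\<^bsub>translation_digraph m\<^esub> w'" "v \<rightarrow>\<^bsub>translation_digraph m\<^esub> w'"
  then have lt: "u < ?n" "v < ?n" "w < ?n" "w' < ?n"
    unfolding translation_digraph_def by simp_all
  obtain a b c d where abcd: "a < m" "b < m" "c < m" "d < m"
    and cong: "[u + 2 ^ a = w] (mod ?n)" "[v + 2 ^ b = w] (mod ?n)"
      "[u + 2 ^ c = w'] (mod ?n)" "[v + 2 ^ d = w'] (mod ?n)"
    using A unfolding translation_digraph_def dominates_residue_digraph by blast
  have "[(u + 2 ^ a) + (v + 2 ^ d) = w + w'] (mod ?n)"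
    using cong by (intro cong_add)
  moreover have "[(v + 2 ^ b) + (u + 2 ^ c) = w + w'] (mod ?n)"
    using cong by (intro cong_add)
  ultimately have "[(u + v) + (2 ^ a + 2 ^ d) = (u + v) + (2 ^ b + 2 ^ c)] (mod ?n)"
    by (simp add: cong_def algebra_simps)
  then have "[2 ^ a + 2 ^ d = 2 ^ b + 2 ^ c] (mod ?n)"
    by (simp only: cong_add_lcancel_nat)
  then have "a = b \<or> a = c" by (rule power_two_sums_cong) (use abcd in auto)
  then show "w = w'"
  proof
    assume "a = b"
    with cong have "[u + 2 ^ a = v + 2 ^ a] (mod ?n)" by (simp add: cong_def)
    then have "u = v"
      using lt cong_add_rcancel_nat cong_less_modulus_unique_nat by blast
    with assms show ?thesis by simp
  next
    assume "a = c"
    with cong have "[w = w'] (mod ?n)" by (simp add: cong_def)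
    with lt show ?thesis using cong_less_modulus_unique_nat by blast
  qed
qed

lemma sum_digraph_common:
  assumes "u \<noteq> v"
  shows "card {w. u \<rightarrow>\<^bsub>sum_digraph m\<^esub> w \<and> v \<rightarrow>\<^bsub>sum_digraph m\<^esub> w} \<le> 1"
proof (rule card_le_1I, safe)
  let ?n = "2 ^ Suc m :: nat"
  fix w w' assume A: "u \<rightarrow>\<^bsub>sum_digraph m\<^esub> w" "v \<rightarrow>\<^bsub>sum_digraph m\<^esub> w"
    "u \<rightarrow>\<^bsub>sum_digraph m\<^esub> w'" "v \<rightarrow>\<^bsub>sum_digraph m\<^esub> w'"
  then have lt: "u < ?n" "v < ?n" "w < ?n" "w' < ?n"
    unfolding sum_digraph_def by simp_all
  obtain a b c d where abcd: "a < m" "b < m" "c < m" "d < m"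
    and cong: "[u + w = 2 ^ a] (mod ?n)" "[v + w = 2 ^ b] (mod ?n)"
      "[u + w' = 2 ^ c] (mod ?n)" "[v + w' = 2 ^ d] (mod ?n)"
    using A unfolding sum_digraph_def dominates_residue_digraph by blast
  have "[(u + w) + (v + w') = 2 ^ a + 2 ^ d] (mod ?n)"
    using cong by (intro cong_add)
  moreover have "[(v + w) + (u + w') = 2 ^ b + 2 ^ c] (mod ?n)"
    using cong by (intro cong_add)
  ultimately have "[2 ^ a + 2 ^ d = 2 ^ b + 2 ^ c] (mod ?n)"
    by (simp add: cong_def algebra_simps)
  then have "a = b \<or> a = c" by (rule power_two_sums_cong) (use abcd in auto)
  then show "w = w'"
  proof
    assume "a = b"
    with cong have "[u + w = v + w] (mod ?n)" by (simp add: cong_def)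
    then have "u = v"
      using lt cong_add_rcancel_nat cong_less_modulus_unique_nat by blast
    with assms show ?thesis by simp
  next
    assume "a = c"
    with cong have "[u + w = u + w'] (mod ?n)" by (simp add: cong_def)
    with lt show ?thesis using cong_add_lcancel_nat cong_less_modulus_unique_nat by blast
  qed
qed

lemma translation_neq:
  assumes "i < m" "[x + 2 ^ i = y] (mod 2 ^ Suc m)"
  shows "x \<noteq> (y :: nat)"
proof
  assume "x = y"
  with assms(2) have "[y + 2 ^ i = y + 0] (mod 2 ^ Suc m)" by simp
  then have "[2 ^ i = 0] (mod (2::nat) ^ Suc m)" by (simp only: cong_add_lcancel_nat)
  then have "(2::nat) ^ Suc m dvd 2 ^ i" by (simp add: cong_0_iff)
  then have "(2::nat) ^ Suc m \<le> 2 ^ i" by (rule dvd_imp_le) simp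
  with assms(1) show False by (simp only: power_increasing_iff)
qed

lemma translation_digraph_degree:
  assumes "x \<in> verts (translation_digraph m)"
  shows "m \<le> card {y. x \<rightarrow>\<^bsub>translation_digraph m\<^esub> y}"
proof -
  let ?n = "2 ^ Suc m :: nat"
  let ?g = "\<lambda>i. (x + 2 ^ i) mod ?n"
  have "inj_on ?g {..<m}"
  proof (rule inj_onI)
    fix i j assume "i \<in> {..<m}" "j \<in> {..<m}" "?g i = ?g j"
    then have "[x + 2 ^ i = x + 2 ^ j] (mod ?n)" by (simp only: cong_def)
    then have "[2 ^ i = 2 ^ j] (mod ?n)" by (simp only: cong_add_lcancel_nat)
    then show "i = j" by (rule power_two_cong) (use \<open>i \<in> _\<close> \<open>j \<in> _\<close> in auto)
  qed
  then have "card (?g ` {..<m}) = m" by (simp add: card_image)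
  moreover have "?g ` {..<m} \<subseteq> {y. x \<rightarrow>\<^bsub>translation_digraph m\<^esub> y}"
  proof safe
    fix i assume "i < m"
    have "[x + 2 ^ i = ?g i] (mod ?n)" by (simp add: cong_def)
    with \<open>i < m\<close> translation_neq[OF \<open>i < m\<close> this] assms
    show "x \<rightarrow>\<^bsub>translation_digraph m\<^esub> ?g i"
      unfolding translation_digraph_def dominates_residue_digraph by auto
  qed
  moreover have "finite {y. x \<rightarrow>\<^bsub>translation_digraph m\<^esub> y}"
    by (rule finite_subset[of _ "{..<?n}"]) (auto simp: translation_digraph_def)
  ultimately show ?thesis by (metis card_mono)
qed

lemma reflection_cong:
  fixes n x :: nat
  assumes "x < n"
  shows "[x + (k + n - x) mod n = k] (mod n)"
  using assms by (simp add: cong_def mod_simps)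

text \<open>
  One is lost because \<open>x + x\<close> may itself be a power of two; by injectivity this happens for at most
  one exponent.
\<close>

lemma sum_digraph_degree:
  assumes "x \<in> verts (sum_digraph m)"
  shows "m - 1 \<le> card {y. x \<rightarrow>\<^bsub>sum_digraph m\<^esub> y}"
proof -
  let ?n = "2 ^ Suc m :: nat"
  let ?g = "\<lambda>i. (2 ^ i + ?n - x) mod ?n"
  from assms have x: "x < ?n" by (simp add: sum_digraph_def)
  have g: "[x + ?g i = 2 ^ i] (mod ?n)" for i
    using x by (rule reflection_cong)
  have "inj_on ?g {..<m}"
  proof (rule inj_onI)
    fix i j assume "i \<in> {..<m}" "j \<in> {..<m}" "?g i = ?g j"
    then have "[2 ^ i = 2 ^ j] (mod ?n)" using g[of i] g[of j] by (metis cong_def)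
    then show "i = j" by (rule power_two_cong) (use \<open>i \<in> _\<close> \<open>j \<in> _\<close> in auto)
  qed
  then have "card (?g ` {..<m}) = m" by (simp add: card_image)
  then have "m - 1 \<le> card (?g ` {..<m} - {x})"
    by (metis diff_card_le_card_Diff card_Diff_singleton_if diff_le_self le_refl)
  also have "\<dots> \<le> card {y. x \<rightarrow>\<^bsub>sum_digraph m\<^esub> y}"
  proof (rule card_mono)
    show "finite {y. x \<rightarrow>\<^bsub>sum_digraph m\<^esub> y}"
      by (rule finite_subset[of _ "{..<?n}"]) (auto simp: sum_digraph_def)
    show "?g ` {..<m} - {x} \<subseteq> {y. x \<rightarrow>\<^bsub>sum_digraph m\<^esub> y}"
      using x g unfolding sum_digraph_def dominates_residue_digraph by auto
  qed
  finally show ?thesis .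
qed

lemma translation_digraph_strongly_connected:
  assumes "0 < m"
  shows "strongly_connected (translation_digraph m)"
  unfolding translation_digraph_def
proof (rule strongly_connected_residue_digraph)
  let ?n = "2 ^ Suc m :: nat"
  let ?G = "residue_digraph ?n (\<lambda>x y. \<exists>i<m. [x + 2 ^ i = y] (mod ?n))"
  interpret digraph ?G by (rule digraph_residue_digraph)
  fix x assume "x < ?n"
  have "[x + 2 ^ 0 = (x + 1) mod ?n] (mod ?n)" by (simp add: cong_def)
  with assms \<open>x < ?n\<close> translation_neq[OF assms this] have "x \<rightarrow>\<^bsub>?G\<^esub> ((x + 1) mod ?n)"
    unfolding dominates_residue_digraph by auto
  then show "x \<rightarrow>\<^sup>*\<^bsub>?G\<^esub> ((x + 1) mod ?n)" by (rule reachable_adjI)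
qed simp

text \<open>
  The walk \<open>x\<close>, \<open>1 - x\<close>, \<open>2 - (1 - x) = x + 1\<close> uses the sums \<open>1 = 2 ^ 0\<close> and \<open>2 = 2 ^ 1\<close>, whence the
  condition on \<open>m\<close>.
\<close>

lemma sum_digraph_strongly_connected:
  assumes "1 < m"
  shows "strongly_connected (sum_digraph m)"
  unfolding sum_digraph_def
proof (rule strongly_connected_residue_digraph)
  let ?n = "2 ^ Suc m :: nat"
  let ?G = "residue_digraph ?n (\<lambda>x y. \<exists>i<m. [x + y = 2 ^ i] (mod ?n))"
  interpret digraph ?G by (rule digraph_residue_digraph)
  \<comment> \<open>Consecutive vertices of the walk may coincide, in which case there is no arc between them.\<close>
  have reach: "x \<rightarrow>\<^sup>*\<^bsub>?G\<^esub> y" if "x < ?n" "y < ?n" "i < m" "[x + y = 2 ^ i] (mod ?n)" for x y i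
  proof (cases "x = y")
    case True
    have "x \<in> verts ?G" unfolding verts_residue_digraph using that(1) by (rule lessThan_iff[THEN iffD2])
    then have "x \<rightarrow>\<^sup>*\<^bsub>?G\<^esub> x" by (rule reachable_refl)
    then show ?thesis unfolding True .
  next
    case False
    then have "x \<rightarrow>\<^bsub>?G\<^esub> y" unfolding dominates_residue_digraph using that by blast
    then show ?thesis by (rule reachable_adjI)
  qed
  fix x assume x: "x < ?n"
  let ?y = "(1 + ?n - x) mod ?n"
  have y: "[x + ?y = 2 ^ 0] (mod ?n)" using reflection_cong[OF x, of 1] by simp
  have "[(x + ?y) + (x + 1) mod ?n = (x + ?y) + (x + 1)] (mod ?n)"
    unfolding cong_def by (rule mod_add_right_eq)
  also have "[(x + ?y) + (x + 1) = 2 ^ 0 + (x + 1)] (mod ?n)"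
    using y by (intro cong_add) auto
  also have "2 ^ 0 + (x + 1) = x + 2 ^ 1" by simp
  finally have z: "[?y + (x + 1) mod ?n = 2 ^ 1] (mod ?n)"
    by (simp only: add.assoc cong_add_lcancel_nat)
  have "x \<rightarrow>\<^sup>*\<^bsub>?G\<^esub> ?y" by (rule reach[OF x _ _ y]) (use assms in auto)
  also have "?y \<rightarrow>\<^sup>*\<^bsub>?G\<^esub> ((x + 1) mod ?n)" by (rule reach[OF _ _ _ z]) (use assms in auto)
  finally show "x \<rightarrow>\<^sup>*\<^bsub>?G\<^esub> ((x + 1) mod ?n)" .
qed simp

text \<open>
  Opposite arcs would give \<open>2 ^ i + 2 ^ j = 0\<close> modulo \<open>2 ^ Suc m\<close>, but the sum is positive and smaller
  than the modulus.
\<close>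

lemma translation_digraph_oriented:
  assumes "x \<rightarrow>\<^bsub>translation_digraph m\<^esub> y"
  shows "\<not> y \<rightarrow>\<^bsub>translation_digraph m\<^esub> x"
proof
  let ?n = "2 ^ Suc m :: nat"
  assume "y \<rightarrow>\<^bsub>translation_digraph m\<^esub> x"
  with assms obtain i j where ij: "i < m" "j < m"
    "[x + 2 ^ i = y] (mod ?n)" "[y + 2 ^ j = x] (mod ?n)"
    unfolding translation_digraph_def dominates_residue_digraph by blast
  then have "[(x + 2 ^ i) + (y + 2 ^ j) = y + x] (mod ?n)" by (intro cong_add)
  then have "[(x + y) + (2 ^ i + 2 ^ j) = (x + y) + 0] (mod ?n)" by (simp add: algebra_simps)
  then have "[2 ^ i + 2 ^ j = 0] (mod ?n)" by (simp only: cong_add_lcancel_nat)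
  then have "?n dvd 2 ^ i + 2 ^ j" by (simp add: cong_0_iff)
  then have "?n \<le> 2 ^ i + 2 ^ j" by (rule dvd_imp_le) simp
  moreover have "(2::nat) ^ i < 2 ^ m" "(2::nat) ^ j < 2 ^ m" using ij by simp_all
  ultimately show False by simp
qed

lemma sum_digraph_symmetric: "symmetric (sum_digraph m)"
  unfolding symmetric_def sum_digraph_def by (rule symI) (auto simp: add.commute)

section \<open>Induced copies of a fixed digraph\<close>

lemma arcs_ends_app_iso:
  assumes "pre_digraph.digraph_isomorphism S f"
  shows "arcs_ends (app_iso f S) = map_prod (iso_verts f) (iso_verts f) ` arcs_ends S"
  using assms unfolding pre_digraph.digraph_isomorphism_def arcs_ends_conv image_image
  by (auto intro!: image_cong)

lemma induced_free_symmetric: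
  assumes "symmetric G" "\<not> symmetric H"
  shows "induced_free H G"
  unfolding induced_free_def
proof clarify
  fix S assume "induced_subgraph S G" "digraph_iso S H"
  then obtain f where f: "pre_digraph.digraph_isomorphism S f" "H = app_iso f S"
    unfolding digraph_iso_def by blast
  have "symmetric S"
    using assms(1) \<open>induced_subgraph S G\<close> by (rule induced_graph_imp_symmetric)
  then have "symmetric H"
    unfolding symmetric_def f(2) arcs_ends_app_iso[OF f(1)] by (auto simp: sym_def)
  with assms(2) show False by simp
qed

lemma induced_free_oriented:
  assumes oriented: "\<And>x y. x \<rightarrow>\<^bsub>G\<^esub> y \<Longrightarrow> \<not> y \<rightarrow>\<^bsub>G\<^esub> x"
    and H: "u \<rightarrow>\<^bsub>H\<^esub> v" "v \<rightarrow>\<^bsub>H\<^esub> u"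
  shows "induced_free H G"
  unfolding induced_free_def
proof clarify
  fix S assume S: "induced_subgraph S G" "digraph_iso S H"
  then obtain f where f: "pre_digraph.digraph_isomorphism S f" "H = app_iso f S"
    unfolding digraph_iso_def by blast
  interpret wf_digraph S
    using f(1) by (simp add: pre_digraph.digraph_isomorphism_def)
  have sub: "arcs_ends S \<subseteq> arcs_ends G"
    using S(1) by (intro arcs_ends_mono induced_imp_subgraph)
  from H(1) obtain a b where ab: "a \<rightarrow>\<^bsub>S\<^esub> b" "u = iso_verts f a" "v = iso_verts f b"
    unfolding f(2) arcs_ends_app_iso[OF f(1)] by auto
  from H(2) obtain c d where cd: "c \<rightarrow>\<^bsub>S\<^esub> d" "v = iso_verts f c" "u = iso_verts f d"
    unfolding f(2) arcs_ends_app_iso[OF f(1)] by auto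
  have inj: "inj_on (iso_verts f) (verts S)"
    using f(1) by (simp add: pre_digraph.digraph_isomorphism_def)
  have "c = b"
    using inj_onD[OF inj, of c b] ab(3) cd(2) adj_in_verts[OF ab(1)] adj_in_verts[OF cd(1)] by metis
  moreover have "d = a"
    using inj_onD[OF inj, of d a] ab(2) cd(3) adj_in_verts[OF ab(1)] adj_in_verts[OF cd(1)] by metis
  ultimately show False using ab(1) cd(1) sub oriented by blast
qed

text \<open>
  Without arcs, reachability in the underlying undirected graph is equality.
\<close>

lemma connected_has_arc:
  assumes "Digraph_Component.connected H" "card (verts H) \<ge> 2"
  obtains u v where "u \<rightarrow>\<^bsub>H\<^esub> v"
proof (rule ccontr)
  assume "\<not> thesis"
  with that have "arcs_ends H = {}" by auto
  then have "arcs H = {}" by (simp add: arcs_ends_conv)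
  then have "arcs_ends (with_proj (mk_symmetric H)) = {}"
    by (simp add: arcs_ends_conv parcs_mk_symmetric)
  moreover have "u \<rightarrow>\<^sup>*\<^bsub>with_proj (mk_symmetric H)\<^esub> v" if "u \<in> verts H" "v \<in> verts H" for u v
    using assms(1) that by (auto simp: connected_def strongly_connected_def)
  ultimately have "u = v" if "u \<in> verts H" "v \<in> verts H" for u v
    using that by (metis reachable_rtranclI rtrancl_empty pair_in_Id_conv)
  then have "card (verts H) \<le> 1" by (rule card_le_1I)
  with assms(2) show False by simp
qed

theorem theorem2:
  fixes H :: "('a, 'b) pre_digraph"
  assumes "weakly_connected_digraph H"
    and "card (verts H) \<ge> 2"
  shows "\<not> bounded_cop_number (free_strong_digraphs H)"
proof
  assume "bounded_cop_number (free_strong_digraphs H)"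
  then obtain C where C: "\<And>D. D \<in> free_strong_digraphs H \<Longrightarrow> cop_number D \<le> C"
    unfolding bounded_cop_number_def by blast
  have bound: False if "digraph D" "strongly_connected D" "induced_free H D" "C < cop_number D"
    for D :: "(nat, nat \<times> nat) pre_digraph"
  proof -
    interpret digraph D by fact
    have "Digraph_Component.connected D"
      using that(2) reachable_mk_symmetricI by (simp add: connected_def strongly_connected_def)
    then have "D \<in> free_strong_digraphs H"
      using that by (simp add: free_strong_digraphs_def weakly_connected_digraph_def)
    from C[OF this] that(4) show False by simp
  qed
  show False
  proof (cases "symmetric H")
    case True
    obtain u v where "u \<rightarrow>\<^bsub>H\<^esub> v"
      using assms connected_has_arc by (auto simp: weakly_connected_digraph_def)
    from True this have "v \<rightarrow>\<^bsub>H\<^esub> u" by (rule arcs_ends_symmetric)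
    let ?D = "translation_digraph (2 * C + 1)"
    have dig: "digraph ?D" unfolding translation_digraph_def by (rule digraph_residue_digraph)
    have "induced_free H ?D"
      using translation_digraph_oriented \<open>u \<rightarrow>\<^bsub>H\<^esub> v\<close> \<open>v \<rightarrow>\<^bsub>H\<^esub> u\<close>
      by (rule induced_free_oriented)
    moreover have "strongly_connected ?D" by (rule translation_digraph_strongly_connected) simp
    moreover from this have "C < cop_number ?D"
      using dig translation_digraph_degree[of _ "2 * C + 1"] translation_digraph_common
      by (intro less_cop_number) (force simp: digraph_def strongly_connected_def)+
    ultimately show False using bound dig by blast
  next
    case False
    \<comment> \<open>One more than in the oriented case, to make up for the excluded loop.\<close>
    let ?D = "sum_digraph (2 * C + 2)"
    have dig: "digraph ?D" unfolding sum_digraph_def by (rule digraph_residue_digraph)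
    have "induced_free H ?D"
      using sum_digraph_symmetric False by (rule induced_free_symmetric)
    moreover have "strongly_connected ?D" by (rule sum_digraph_strongly_connected) simp
    moreover from this have "C < cop_number ?D"
      using dig sum_digraph_degree[of _ "2 * C + 2"] sum_digraph_common
      by (intro less_cop_number) (force simp: digraph_def strongly_connected_def)+
    ultimately show False using bound dig by blast
  qed
qed

end
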